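(* Let $n,k,\ell$ be integers with $3\leq k\leq n$ and $1\leq \ell\leq \lfloor\frac{k-1}{2}\rfloor$. Then $$f(n;\overline{\kappa}_k\leq \ell)\geq \binom{k-1}{2}+(n-k+1)\ell \quad\text{and}\quad g(n;\overline{\lambda}_k\leq \ell)\geq \binom{k-1}{2}+(n-k+1)\ell.$$ Moreover, these two bounds are sharp for $k=n$ and $k=n-1$: for $k=n$ with $n\geq 6$, and for $k=n-1$ with $n\geq 12$, there is some $\ell$ with $1\leq \ell\leq \lfloor\frac{k-1}{2}\rfloor$ for which equality holds in both inequalities.
   Context: All graphs are finite, simple and undirected; $e(G)$ is the number of edges of $G$. For a graph $G$ and $S\subseteq V(G)$ with $|S|\geq 2$, a tree connecting $S$ is a subgraph of $G$ that is a tree whose vertex set contains $S$. Two trees $T,T'$ connecting $S$ are internally disjoint if $E(T)\cap E(T')=\varnothing$ and $V(T)\cap V(T')=S$. Let $\kappa(S)$ (resp. $\lambda(S)$) be the maximum number of pairwise internally disjoint (resp. pairwise edge-disjoint) trees connecting $S$ in $G$. For $2\leq k\leq |V(G)|$, $\overline{\kappa}_k(G)=\max\{\kappa(S): S\subseteq V(G),\ |S|=k\}$ and $\overline{\lambda}_k(G)=\max\{\lambda(S): S\subseteq V(G),\ |S|=k\}$. Define $f(n;\overline{\kappa}_k\leq \ell)=\max\{e(G): |V(G)|=n,\ \overline{\kappa}_k(G)\leq \ell\}$ and $g(n;\overline{\lambda}_k\leq \ell)=\max\{e(G): |V(G)|=n,\ \overline{\lambda}_k(G)\leq \ell\}$.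 *)

theory Defs
  imports Complex_Main
begin

(* A graph is a pair of a vertex set and a set of two-element vertex sets. The digraph-based notions
   of tree and cycle in AFP Graph_Theory do not fit: in a symmetric digraph
   the two arcs representing one undirected edge already form a cycle. *)

type_synonym 'a ugraph = "'a set \<times> 'a set set"

abbreviation vertices :: "'a ugraph \<Rightarrow> 'a set" where
  "vertices G \<equiv> fst G"

abbreviation edges :: "'a ugraph \<Rightarrow> 'a set set" where
  "edges G \<equiv> snd G"

definition simple_graph :: "'a ugraph \<Rightarrow> bool" where
  "simple_graph G \<longleftrightarrow> finite (vertices G) \<and> (\<forall>e\<in>edges G. e \<subseteq> vertices G \<and> card e = 2)"

definition is_subgraph :: "'a ugraph \<Rightarrow> 'a ugraph \<Rightarrow> bool" where
  "is_subgraph H G \<longleftrightarrow> simple_graph H \<and> vertices H \<subseteq> vertices G \<and> edges H \<subseteq> edges G"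

definition connected_graph :: "'a ugraph \<Rightarrow> bool" where
  "connected_graph G \<longleftrightarrow> vertices G \<noteq> {} \<and>
     (\<forall>u\<in>vertices G. \<forall>v\<in>vertices G. (u, v) \<in> {(x, y). {x, y} \<in> edges G}\<^sup>*)"

definition is_cycle :: "'a ugraph \<Rightarrow> 'a list \<Rightarrow> bool" where
  "is_cycle G c \<longleftrightarrow> 3 \<le> length c \<and> distinct c \<and>
     (\<forall>i<length c. {c ! i, c ! (Suc i mod length c)} \<in> edges G)"

definition is_tree :: "'a ugraph \<Rightarrow> bool" where
  "is_tree T \<longleftrightarrow> simple_graph T \<and> connected_graph T \<and> (\<nexists>c. is_cycle T c)"

definition tree_connecting :: "'a ugraph \<Rightarrow> 'a set \<Rightarrow> 'a ugraph \<Rightarrow> bool" where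
  "tree_connecting G S T \<longleftrightarrow> is_subgraph T G \<and> is_tree T \<and> S \<subseteq> vertices T"

definition edge_disjoint :: "'a ugraph \<Rightarrow> 'a ugraph \<Rightarrow> bool" where
  "edge_disjoint T T' \<longleftrightarrow> edges T \<inter> edges T' = {}"

definition internally_disjoint :: "'a set \<Rightarrow> 'a ugraph \<Rightarrow> 'a ugraph \<Rightarrow> bool" where
  "internally_disjoint S T T' \<longleftrightarrow>
     edges T \<inter> edges T' = {} \<and> vertices T \<inter> vertices T' = S"

(* For graphs on n vertices and 2 \<le> k \<le> n, every set under Max below is finite and
   nonempty, so Max is a genuine maximum. Sets of trees suffice (no multisets): when card S \<ge> 2
   every tree connecting S has an edge, so disjoint trees are automatically distinct. *)

definition kappa :: "'a ugraph \<Rightarrow> 'a set \<Rightarrow> nat" where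
  "kappa G S = Max {card F | F. (\<forall>T\<in>F. tree_connecting G S T) \<and> pairwise (internally_disjoint S) F}"

definition lambda :: "'a ugraph \<Rightarrow> 'a set \<Rightarrow> nat" where
  "lambda G S = Max {card F | F. (\<forall>T\<in>F. tree_connecting G S T) \<and> pairwise edge_disjoint F}"

definition kappa_bar :: "nat \<Rightarrow> 'a ugraph \<Rightarrow> nat" where
  "kappa_bar k G = Max {kappa G S | S. S \<subseteq> vertices G \<and> card S = k}"

definition lambda_bar :: "nat \<Rightarrow> 'a ugraph \<Rightarrow> nat" where
  "lambda_bar k G = Max {lambda G S | S. S \<subseteq> vertices G \<and> card S = k}"

(* Every finite graph is isomorphic to one whose vertices are natural numbers,
   so it suffices to let G range over these. *)

definition f_max :: "nat \<Rightarrow> nat \<Rightarrow> nat \<Rightarrow> nat" where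
  "f_max n k l = Max {card (edges G) | G :: nat ugraph.
     simple_graph G \<and> card (vertices G) = n \<and> kappa_bar k G \<le> l}"

definition g_max :: "nat \<Rightarrow> nat \<Rightarrow> nat \<Rightarrow> nat" where
  "g_max n k l = Max {card (edges G) | G :: nat ugraph.
     simple_graph G \<and> card (vertices G) = n \<and> lambda_bar k G \<le> l}"

end

theory Submission
  imports Defs
begin

text \<open>
  For the lower bounds, join each of \<open>n - k + 1\<close> further vertices to \<open>l\<close> vertices of a complete graph
  on \<open>k - 1\<close> vertices. Every \<open>k\<close>-set contains a vertex of degree \<open>l\<close>, and
  edge-disjoint trees through that vertex use different edges there.

  Sharpness holds already for \<open>l = 1\<close>. A graph on \<open>n \<ge> 5\<close> vertices with at most \<open>n - 3\<close> missing edges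
  has two edge-disjoint spanning trees: delete a vertex incident with a missing edge and
  attach it again as a leaf of both trees. For \<open>k = n - 1\<close>
  there are at most \<open>2 * n - 6\<close> missing edges. If some vertex has at most one neighbour, delete it and
  apply the previous result. Otherwise delete a vertex incident with the most missing edges and use
  induction; starting from \<open>n = 12\<close>, averaging makes the number of missing edges drop fast
  enough to arrive at at most five missing edges on seven vertices.
\<close>

section \<open>Trees built leaf by leaf\<close>

text \<open>Trees are generated rather than tested, so that attaching a vertex to a tree already
  built is one rule application; \<open>leaf_tree_is_tree\<close> leads back to
  \<open>is_tree\<close>.\<close>

inductive leaf_tree :: "'a set \<Rightarrow> 'a set set \<Rightarrow> bool" where
  single: "leaf_tree {v} {}"
| leaf: "leaf_tree V E \<Longrightarrow> u \<in> V \<Longrightarrow> v \<notin> V \<Longrightarrow> leaf_tree (insert v V) (insert {u, v} E)"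

lemma leaf_tree_simple: "leaf_tree V E \<Longrightarrow> simple_graph (V, E)"
  by (induction rule: leaf_tree.induct) (auto simp: simple_graph_def card_insert_if)

lemma leaf_tree_no_edges: "leaf_tree V {} \<Longrightarrow> card V = 1"
  by (erule leaf_tree.cases) auto

lemma leaf_tree_connected: "leaf_tree V E \<Longrightarrow> connected_graph (V, E)"
proof (induction rule: leaf_tree.induct)
  case (single v)
  then show ?case by (simp add: connected_graph_def)
next
  case (leaf V E u v)
  let ?R = "{(x, y). {x, y} \<in> E}" and ?R' = "{(x, y). {x, y} \<in> insert {u, v} E}"
  have "?R\<^sup>* \<subseteq> ?R'\<^sup>*"
    by (rule rtrancl_mono) auto
  then have old: "(x, y) \<in> ?R'\<^sup>*" if "x \<in> V" "y \<in> V" for x y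
    using leaf.IH that by (auto simp: connected_graph_def)
  have uv: "(u, v) \<in> ?R'\<^sup>*" "(v, u) \<in> ?R'\<^sup>*"
    by (rule r_into_rtrancl; simp add: insert_commute)+
  have to: "(x, u) \<in> ?R'\<^sup>*" "(u, x) \<in> ?R'\<^sup>*" if "x \<in> insert v V" for x
    using that old[OF _ leaf.hyps(2)] old[OF leaf.hyps(2)] uv by auto
  have "(x, y) \<in> ?R'\<^sup>*" if "x \<in> insert v V" "y \<in> insert v V" for x y
    using to(1)[OF that(1)] to(2)[OF that(2)] by (rule rtrancl_trans)
  then show ?case
    unfolding connected_graph_def by simp
qed

text \<open>The new vertex \<open>v\<close> has \<open>u\<close> as its only neighbour, so on a
  cycle through \<open>v\<close> both cyclic neighbours of \<open>v\<close> would be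
  \<open>u\<close>. A cycle avoiding \<open>v\<close> already lies in the smaller tree.\<close>

lemma leaf_tree_acyclic: "leaf_tree V E \<Longrightarrow> \<not> is_cycle (V, E) c"
proof (induction rule: leaf_tree.induct)
  case (single v)
  then show ?case by (auto simp: is_cycle_def intro!: exI[of _ 0])
next
  case (leaf V E u v)
  have noV: "v \<notin> e" if "e \<in> E" for e
    using leaf_tree_simple[OF leaf.hyps(1)] leaf.hyps(3) that by (auto simp: simple_graph_def)
  show ?case
  proof
    assume cyc: "is_cycle (insert v V, insert {u, v} E) c"
    let ?n = "length c"
    have n: "3 \<le> ?n" and d: "distinct c"
      and e: "\<And>i. i < ?n \<Longrightarrow> {c ! i, c ! (Suc i mod ?n)} \<in> insert {u, v} E"
      using cyc by (auto simp: is_cycle_def)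
    have at_v: "x = u" if "{v, x} \<in> insert {u, v} E" for x
      using that noV[of "{v, x}"] leaf.hyps(2,3) by (auto simp: doubleton_eq_iff)
    show False
    proof (cases "v \<in> set c")
      case True
      then obtain i where i: "i < ?n" "c ! i = v" by (auto simp: in_set_conv_nth)
      define j where "j = Suc i mod ?n"
      \<comment> \<open>Cyclic predecessor of position \<open>i\<close>, as \<open>j\<close> is its
        successor. Both positions carry \<open>u\<close>, and \<open>j = h\<close> would force a
        cycle of length at most two.\<close>
      define h where "h = (if i = 0 then ?n - 1 else i - 1)"
      have j: "j < ?n" using n unfolding j_def by (intro mod_less_divisor) linarith
      have h: "h < ?n" "Suc h mod ?n = i" using n i(1) by (auto simp: h_def)
      have "c ! j = u" using e[OF i(1)] i(2) at_v by (simp add: j_def)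
      moreover have "c ! h = u"
        using e[OF h(1)] h(2) i(2) at_v by (simp add: insert_commute)
      ultimately have "j = h" using d j h(1) by (metis nth_eq_iff_index_eq)
      moreover have "j = (if Suc i = ?n then 0 else Suc i)" using i(1) by (simp add: j_def)
      ultimately show False using n i(1) by (auto simp: h_def split: if_splits)
    next
      case False
      have "{c ! i, c ! (Suc i mod ?n)} \<in> E" if "i < ?n" for i
      proof -
        have "Suc i mod ?n < ?n" using that by (intro mod_less_divisor) linarith
        then have "v \<notin> {c ! i, c ! (Suc i mod ?n)}" using False that by (auto simp: in_set_conv_nth)
        then show ?thesis using e[OF that] by auto
      qed
      then show False using leaf.IH n d by (auto simp: is_cycle_def)
    qed
  qed
qed

lemma leaf_tree_is_tree: "leaf_tree V E \<Longrightarrow> is_tree (V, E)"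
  by (simp add: is_tree_def leaf_tree_simple leaf_tree_connected leaf_tree_acyclic)

lemma leaf_tree_edge: "leaf_tree V E \<Longrightarrow> e \<in> E \<Longrightarrow> e \<subseteq> V \<and> card e = 2"
  using leaf_tree_simple by (fastforce simp: simple_graph_def)

section \<open>Packing two trees into a nearly complete graph\<close>

definition pairs :: "'a set \<Rightarrow> 'a set set" where
  "pairs V = {e. e \<subseteq> V \<and> card e = 2}"

abbreviation deg :: "'a set set \<Rightarrow> 'a \<Rightarrow> nat" where
  "deg M v \<equiv> card {e \<in> M. v \<in> e}"

lemma finite_pairs: "finite V \<Longrightarrow> finite (pairs V)"
  by (auto simp: pairs_def)

lemma card_pairs: "finite V \<Longrightarrow> card (pairs V) = card V choose 2"
  by (simp add: pairs_def n_subsets)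

lemma card_remove_vertex:
  assumes "finite M"
  shows "card {e \<in> M. v \<notin> e} = card M - deg M v"
proof -
  have "{e \<in> M. v \<notin> e} = M - {e \<in> M. v \<in> e}" by auto
  then show ?thesis using assms by (simp add: card_Diff_subset)
qed

lemma pairs_remove: "M \<subseteq> pairs V \<Longrightarrow> {e \<in> M. v \<notin> e} \<subseteq> pairs (V - {v})"
  by (auto simp: pairs_def)

lemma card_non_neighbours_le:
  assumes "finite M"
  shows "card {u \<in> V - {v}. {u, v} \<in> M} \<le> deg M v"
  by (rule card_inj_on_le[where f = "\<lambda>u. {u, v}"]) (use assms in \<open>auto simp: inj_on_def doubleton_eq_iff\<close>)

text \<open>Of the \<open>card V - 1\<close> other vertices at most \<open>deg M v\<close> are cut
  off from \<open>v\<close> by \<open>M\<close>, which leaves at least two.\<close>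

lemma two_neighbours:
  assumes "finite V" "finite M" "v \<in> V" "deg M v + 3 \<le> card V"
  obtains p q where "p \<in> V - {v}" "q \<in> V - {v}" "p \<noteq> q" "{p, v} \<notin> M" "{q, v} \<notin> M"
proof -
  let ?A = "{u \<in> V - {v}. {u, v} \<notin> M}" and ?B = "{u \<in> V - {v}. {u, v} \<in> M}"
  have "V - {v} = ?A \<union> ?B" by auto
  then have "card (V - {v}) = card ?A + card ?B"
    using assms(1) by (metis (no_types, lifting) card_Un_disjoint finite_Diff finite_Un disjoint_iff mem_Collect_eq)
  moreover have "card (V - {v}) = card V - 1" using assms by simp
  moreover have "card ?B \<le> deg M v" by (rule card_non_neighbours_le[OF assms(2)])
  ultimately have "Suc (Suc 0) \<le> card ?A" using assms(4) by linarith
  then obtain p A where pA: "?A = insert p A" "p \<notin> A" "Suc 0 \<le> card A"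
    by (meson card_le_Suc_iff)
  then obtain q where "q \<in> A" by (metis all_not_in_conv card.empty not_one_le_zero One_nat_def)
  then have "p \<in> ?A" "q \<in> ?A" "p \<noteq> q" using pA by auto
  then show ?thesis using that by blast
qed

text \<open>The degrees sum to \<open>2 * card M\<close> by double counting, and the maximum is at
  least the average.\<close>

lemma ex_max_deg:
  assumes "finite V" "V \<noteq> {}" "M \<subseteq> pairs V"
  obtains v where "v \<in> V" "\<And>u. u \<in> V \<Longrightarrow> deg M u \<le> deg M v" "2 * card M \<le> card V * deg M v"
proof -
  have finM: "finite M" using assms finite_pairs finite_subset by blast
  obtain v where v: "v \<in> V" "\<And>u. u \<in> V \<Longrightarrow> deg M u \<le> deg M v"
  proof -
    have "Max (deg M ` V) \<in> deg M ` V" using assms by (intro Max_in) auto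
    then obtain v where "v \<in> V" "deg M v = Max (deg M ` V)" by auto
    moreover have "deg M u \<le> Max (deg M ` V)" if "u \<in> V" for u
      using assms(1) that by (intro Max_ge) auto
    ultimately show ?thesis using that[of v] by simp
  qed
  have "(\<Sum>u\<in>V. deg M u) = (\<Sum>e\<in>M. 2)"
  proof (rule sum_multicount_gen[OF assms(1) finM], rule ballI)
    fix e assume "e \<in> M"
    then have "card e = 2" "{u \<in> V. u \<in> e} = e" using assms(3) by (auto simp: pairs_def)
    then show "card {u \<in> V. u \<in> e} = 2" by simp
  qed
  moreover have "(\<Sum>u\<in>V. deg M u) \<le> card V * deg M v"
    using sum_bounded_above[of V "deg M" "deg M v"] v by simp
  ultimately show ?thesis using that v by simp
qed

text \<open>\<open>M\<close> plays the role of the missing edges, so the host graph is given by its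
  complement. Two vertex sets are kept because for \<open>k = n - 1\<close> the second tree may run
  through the vertex outside \<open>S\<close>.\<close>

definition two_trees :: "'a set \<Rightarrow> 'a set \<Rightarrow> 'a set set \<Rightarrow> bool" where
  "two_trees V1 V2 M \<longleftrightarrow> (\<exists>E1 E2. leaf_tree V1 E1 \<and> leaf_tree V2 E2 \<and> E1 \<inter> E2 = {} \<and> (E1 \<union> E2) \<inter> M = {})"

lemma two_trees_mono: "two_trees V1 V2 M \<Longrightarrow> M' \<subseteq> M \<Longrightarrow> two_trees V1 V2 M'"
  unfolding two_trees_def by blast

text \<open>Trees that do not contain \<open>v\<close> have no edge at \<open>v\<close>, so the
  missing edges at \<open>v\<close> cannot hurt them.\<close>

lemma two_trees_avoid:
  assumes "two_trees V1 V2 {e \<in> M. v \<notin> e}" "v \<notin> V1" "v \<notin> V2"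
  shows "two_trees V1 V2 M"
proof -
  obtain E1 E2 where E: "leaf_tree V1 E1" "leaf_tree V2 E2" "E1 \<inter> E2 = {}"
    "(E1 \<union> E2) \<inter> {e \<in> M. v \<notin> e} = {}"
    using assms(1) by (auto simp: two_trees_def)
  moreover have "(E1 \<union> E2) \<inter> M = {}"
    using E(4) leaf_tree_edge[OF E(1)] leaf_tree_edge[OF E(2)] assms(2,3) by blast
  ultimately show ?thesis unfolding two_trees_def by blast
qed

lemma two_trees_leaf:
  assumes "two_trees V1 V2 M" "w \<notin> V1" "w \<notin> V2" "y \<in> V2" "{y, w} \<notin> M"
  shows "two_trees V1 (insert w V2) M"
proof -
  obtain E1 E2 where E: "leaf_tree V1 E1" "leaf_tree V2 E2" "E1 \<inter> E2 = {}" "(E1 \<union> E2) \<inter> M = {}"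
    using assms(1) by (auto simp: two_trees_def)
  have "leaf_tree (insert w V2) (insert {y, w} E2)" using leaf[OF E(2)] assms by simp
  moreover have "{y, w} \<notin> E1" using leaf_tree_edge[OF E(1)] assms(2) by blast
  ultimately show ?thesis
    using E assms(5) unfolding two_trees_def
    by (intro exI[of _ E1] exI[of _ "insert {y, w} E2"]) auto
qed

text \<open>The old edges avoid \<open>v\<close>, so only the two new edges can conflict with each
  other or with missing edges at \<open>v\<close>; distinct \<open>p\<close> and \<open>q\<close>
  keep them apart.\<close>

lemma two_trees_leaves:
  assumes "two_trees V1 V2 {e \<in> M. v \<notin> e}" "v \<notin> V1" "v \<notin> V2"
    and "p \<in> V1" "q \<in> V2" "p \<noteq> q" "{p, v} \<notin> M" "{q, v} \<notin> M"
  shows "two_trees (insert v V1) (insert v V2) M"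
proof -
  obtain E1 E2 where E: "leaf_tree V1 E1" "leaf_tree V2 E2" "E1 \<inter> E2 = {}"
    "(E1 \<union> E2) \<inter> {e \<in> M. v \<notin> e} = {}"
    using assms(1) by (auto simp: two_trees_def)
  have T: "leaf_tree (insert v V1) (insert {p, v} E1)" "leaf_tree (insert v V2) (insert {q, v} E2)"
    using leaf[OF E(1)] leaf[OF E(2)] assms by simp_all
  have nv: "v \<notin> e" if "e \<in> E1 \<union> E2" for e
    using that leaf_tree_edge[OF E(1)] leaf_tree_edge[OF E(2)] assms(2,3) by blast
  have "insert {p, v} E1 \<inter> insert {q, v} E2 = {}"
    using E(3) nv assms(6) by (auto simp: doubleton_eq_iff)
  moreover have "(insert {p, v} E1 \<union> insert {q, v} E2) \<inter> M = {}"
    using E(4) nv assms(7,8) by auto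
  ultimately show ?thesis using T unfolding two_trees_def by blast
qed

section \<open>Base case: five vertices and at most two missing edges\<close>

lemma five_vertices_adjacent:
  assumes "distinct [a, b, c, d, e]"
  shows "two_trees {a, b, c, d, e} {a, b, c, d, e} {{a, b}, {a, c}}"
proof -
  \<comment> \<open>The two trees use up all eight remaining edges. Vertices and edges are listed in
    reverse order of attachment, starting from \<open>a\<close>, so that the introduction rules
    match syntactically.\<close>
  have "leaf_tree {e, c, b, d, a} {{c, e}, {b, c}, {d, b}, {a, d}}"
    by (intro leaf_tree.intros) (use assms in auto)
  moreover have "leaf_tree {c, d, b, e, a} {{d, c}, {e, d}, {e, b}, {a, e}}"
    by (intro leaf_tree.intros) (use assms in auto)
  moreover have "{e, c, b, d, a} = {a, b, c, d, e}" "{c, d, b, e, a} = {a, b, c, d, e}" by auto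
  moreover have "{{c, e}, {b, c}, {d, b}, {a, d}} \<inter> {{d, c}, {e, d}, {e, b}, {a, e}} = {}"
    "({{c, e}, {b, c}, {d, b}, {a, d}} \<union> {{d, c}, {e, d}, {e, b}, {a, e}}) \<inter> {{a, b}, {a, c}} = {}"
    using assms by (auto simp: doubleton_eq_iff)
  ultimately show ?thesis unfolding two_trees_def by metis
qed

lemma five_vertices_disjoint:
  assumes "distinct [a, b, c, d, e]"
  shows "two_trees {a, b, c, d, e} {a, b, c, d, e} {{a, b}, {c, d}}"
proof -
  have "leaf_tree {e, d, b, c, a} {{d, e}, {b, d}, {c, b}, {a, c}}"
    by (intro leaf_tree.intros) (use assms in auto)
  moreover have "leaf_tree {c, b, e, d, a} {{e, c}, {e, b}, {a, e}, {a, d}}"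
    by (intro leaf_tree.intros) (use assms in auto)
  moreover have "{e, d, b, c, a} = {a, b, c, d, e}" "{c, b, e, d, a} = {a, b, c, d, e}" by auto
  moreover have "{{d, e}, {b, d}, {c, b}, {a, c}} \<inter> {{e, c}, {e, b}, {a, e}, {a, d}} = {}"
    "({{d, e}, {b, d}, {c, b}, {a, c}} \<union> {{e, c}, {e, b}, {a, e}, {a, d}}) \<inter> {{a, b}, {c, d}} = {}"
    using assms by (auto simp: doubleton_eq_iff)
  ultimately show ?thesis unfolding two_trees_def by metis
qed

text \<open>Two edges either share an endpoint or are disjoint. Inclusions instead of equations let
  the same two patterns cover sets with fewer edges.\<close>

lemma card_two_missing_cases:
  assumes "card V = 5" "M \<subseteq> pairs V" "card M \<le> 2"
  obtains a b c d e where "distinct [a, b, c, d, e]" "V = {a, b, c, d, e}"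
      "M \<subseteq> {{a, b}, {a, c}} \<or> M \<subseteq> {{a, b}, {c, d}}"
proof -
  have finV: "finite V" using assms(1) by (metis card.infinite zero_neq_numeral)
  have finM: "finite M" using assms(2) finV finite_pairs finite_subset by blast
  \<comment> \<open>Names the other three vertices, with \<open>c\<close> reserved for a prescribed
    vertex \<open>x\<close> if \<open>x\<close> is one of them.\<close>
  have rest: "\<exists>c d e. distinct [a, b, c, d, e] \<and> V = {a, b, c, d, e} \<and> (x \<in> {a, b} \<or> x \<notin> V \<or> c = x)"
    if "a \<in> V" "b \<in> V" "a \<noteq> b" for a b x
  proof -
    have c3: "card (V - {a, b}) = 3" using that finV assms(1) by (simp add: card_Diff_subset)
    obtain c where c: "c \<in> V - {a, b}" "x \<in> {a, b} \<or> x \<notin> V \<or> c = x"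
      using c3 by (metis Diff_iff card.empty ex_in_conv zero_neq_numeral)
    then have "card (V - {a, b} - {c}) = 2" using c3 finV by simp
    then obtain d e where "V - {a, b} - {c} = {d, e}" "d \<noteq> e" by (meson card_2_iff)
    then have "distinct [a, b, c, d, e] \<and> V = {a, b, c, d, e}" using c(1) that by auto
    then show ?thesis using c(2) by blast
  qed
  have pair: "\<exists>a b. m = {a, b} \<and> a \<noteq> b \<and> a \<in> V \<and> b \<in> V" if m: "m \<in> pairs V" for m
    using m by (auto simp: pairs_def card_2_iff)
  have pairs_ne: "pairs V \<noteq> {}" using card_pairs[OF finV] assms(1) by (auto simp: numeral_eq_Suc)
  obtain m1 m2 where m: "m1 \<in> pairs V" "m2 \<in> pairs V" "M \<subseteq> {m1, m2}"
  proof -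
    consider "card M = 0" | "card M = 1" | "card M = 2" using assms(3) by linarith
    then show ?thesis
    proof cases
      case 1
      then show ?thesis using that pairs_ne finM by auto
    next
      case 2
      then show ?thesis using that assms(2) by (auto simp: card_1_singleton_iff)
    next
      case 3
      then show ?thesis using that assms(2) by (auto simp: card_2_iff)
    qed
  qed
  obtain p q where p: "m1 = {p, q}" "p \<noteq> q" "p \<in> V" "q \<in> V" using pair[OF m(1)] by blast
  obtain r s where r: "m2 = {r, s}" "r \<noteq> s" "r \<in> V" "s \<in> V" using pair[OF m(2)] by blast
  consider "m1 = m2" | a b c where "m1 = {a, b}" "m2 = {a, c}" "distinct [a, b, c]" "{a, b, c} \<subseteq> V"
    | "distinct [p, q, r, s]"
  proof -
    have "m1 = m2 \<or> distinct [p, q, r, s] \<or>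
      (\<exists>a b c. m1 = {a, b} \<and> m2 = {a, c} \<and> distinct [a, b, c] \<and> {a, b, c} \<subseteq> V)"
    proof (cases "p \<in> m2")
      case True
      then obtain c where "m2 = {p, c}" "c \<noteq> p" "c \<in> V" using r by auto
      then have "c = q \<or> distinct [p, q, c] \<and> {p, q, c} \<subseteq> V" using p by auto
      then show ?thesis using p(1) \<open>m2 = {p, c}\<close> by blast
    next
      case np: False
      show ?thesis
      proof (cases "q \<in> m2")
        case True
        then obtain c where "m2 = {q, c}" "c \<noteq> q" "c \<in> V" using r by auto
        moreover from this have "m1 = {q, p} \<and> distinct [q, p, c] \<and> {q, p, c} \<subseteq> V" using p np by auto
        ultimately show ?thesis by blast
      next
        case False
        then show ?thesis using np p r by auto
      qed
    qed
    then show ?thesis using that by blast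
  qed
  then show ?thesis
  proof cases
    case 1
    from rest[OF p(3,4,2)] obtain c d e where "distinct [p, q, c, d, e]" "V = {p, q, c, d, e}" by blast
    then show ?thesis using that[of p q c d e] m(3) p(1) 1 by blast
  next
    case 2
    then have "a \<in> V" "b \<in> V" "a \<noteq> b" "c \<in> V" "c \<notin> {a, b}" by auto
    from rest[OF this(1-3), of c] this obtain d e where
      "distinct [a, b, c, d, e]" "V = {a, b, c, d, e}" by blast
    then show ?thesis using that[of a b c d e] m(3) 2 by blast
  next
    case 3
    have c: "card (V - {p, q, r, s}) = 1"
      using 3 p r finV assms(1) by (simp add: card_Diff_subset)
    then obtain e where e: "V - {p, q, r, s} = {e}" by (auto simp: card_1_singleton_iff)
    then have "V = {p, q, r, s, e}" "distinct [p, q, r, s, e]" using 3 p r by auto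
    then show ?thesis using that[of p q r s e] m(3) p(1) r(1) by blast
  qed
qed

text \<open>Deleting a vertex incident with a missing edge lowers both sides of the bound, and the
  at most \<open>card V - 3\<close> missing edges leave it two neighbours for coming back as a leaf
  of both trees. One more missing edge could leave a vertex of degree one.\<close>

lemma two_spanning_trees:
  assumes "finite V" "M \<subseteq> pairs V" "5 \<le> card V" "card M \<le> card V - 3"
  shows "two_trees V V M"
  using assms
proof (induction "card V" arbitrary: V M rule: less_induct)
  case (less V M)
  show ?case
  proof (cases "card V = 5")
    case True
    then have "card V = 5" "card M \<le> 2" using less.prems by auto
    from card_two_missing_cases[OF this(1) less.prems(2) this(2)] obtain a b c d e where
      abc: "distinct [a, b, c, d, e]" "V = {a, b, c, d, e}"
        "M \<subseteq> {{a, b}, {a, c}} \<or> M \<subseteq> {{a, b}, {c, d}}" .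
    then show ?thesis
      using five_vertices_adjacent[OF abc(1)] five_vertices_disjoint[OF abc(1)] two_trees_mono by blast
  next
    case False
    define n where "n = card V - 1"
    have n: "card V = Suc n" and n5: "5 \<le> n" using less.prems(3) False by (auto simp: n_def)
    have finM: "finite M" using less.prems finite_pairs finite_subset by blast
    obtain v where v: "v \<in> V" "M = {} \<or> 1 \<le> deg M v"
    proof (cases "M = {}")
      case True
      then show ?thesis using that n by (metis card.empty ex_in_conv nat.distinct(1))
    next
      case False
      then obtain e where e: "e \<in> M" by blast
      then have "e \<subseteq> V" "card e = 2" using less.prems by (auto simp: pairs_def)
      then obtain v where "v \<in> e" "v \<in> V" by (metis card.empty ex_in_conv subsetD zero_neq_numeral)
      moreover have "deg M v \<noteq> 0" using e \<open>v \<in> e\<close> finM by auto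
      ultimately show ?thesis using that by force
    qed
    let ?V = "V - {v}" and ?M = "{e \<in> M. v \<notin> e}"
    have cV: "n = card ?V" using v n less.prems(1) by simp
    have "deg M v \<le> card M" using finM by (intro card_mono) auto
    then have dv: "deg M v + 3 \<le> card V" using less.prems(4) n n5 by linarith
    have "card ?M \<le> card ?V - 3"
      using v(2) card_remove_vertex[OF finM, of v] less.prems(4) n cV n5 by auto
    then have T: "two_trees ?V ?V ?M"
      using less.hyps[of ?V ?M] less.prems(1) pairs_remove[OF less.prems(2)] n n5 cV by simp
    obtain p q where "p \<in> ?V" "q \<in> ?V" "p \<noteq> q" "{p, v} \<notin> M" "{q, v} \<notin> M"
      using two_neighbours[OF less.prems(1) finM v(1) dv] .
    then have "two_trees (insert v ?V) (insert v ?V) M"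
      by (intro two_trees_leaves[OF T, of p q]) auto
    then show ?thesis using v(1) by (simp add: insert_absorb)
  qed
qed

text \<open>The three ranges are those in which averaging provides a vertex incident with at least
  two, three and two missing edges, respectively, as long as the bound is nearly attained.\<close>

definition missing_bound :: "nat \<Rightarrow> nat" where
  "missing_bound n = (if n \<le> 9 then 2 * n - 9 else if n \<le> 12 then 3 * n - 18 else 2 * n - 6)"

text \<open>The bound grows by at most three, which settles \<open>3 \<le> d\<close>. It grows by
  three only from \<open>n = 9, 10, 11\<close>; there \<open>d = 2\<close> gives
  \<open>m \<le> n + 1\<close>, so \<open>m - 2\<close> is below the bound anyway. For
  \<open>d \<le> 1\<close> the averaging hypothesis makes \<open>m\<close> small.\<close>

lemma missing_bound_Suc:
  assumes "7 \<le> n" "m \<le> missing_bound (Suc n)" "2 * m \<le> Suc n * d"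
  shows "m - d \<le> missing_bound n"
proof -
  consider "3 \<le> d" | "d = 2" | "d = 1" | "d = 0" by linarith
  then show ?thesis
    by cases (use assms in \<open>auto simp: missing_bound_def split: if_splits\<close>)
qed

text \<open>Four or five edges on seven vertices force degree at least two somewhere. Three is what
  \<open>two_spanning_trees\<close> tolerates on the remaining six vertices.\<close>

lemma missing_bound_7:
  assumes "m \<le> missing_bound 7" "2 * m \<le> 7 * d"
  shows "m - d \<le> 3"
  using assms by (auto simp: missing_bound_def)

text \<open>The set to be connected is \<open>V - {w}\<close>: the first tree has exactly these
  vertices, and the second may in addition use \<open>w\<close>. The induction keeps
  \<open>w\<close> and reattaches the deleted vertex to both trees.\<close>

lemma two_trees_one_avoiding_vertex:
  assumes "finite V" "M \<subseteq> pairs V" "7 \<le> card V" "card M \<le> missing_bound (card V)"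
  shows "\<exists>w\<in>V. \<exists>U. (U = V \<or> U = V - {w}) \<and> two_trees (V - {w}) U M"
  using assms
proof (induction "card V" arbitrary: V M rule: less_induct)
  case (less V M)
  show ?case
  proof (cases "card V = 7")
    case True
    have finM: "finite M" using less.prems finite_pairs finite_subset by blast
    have "V \<noteq> {}" using True less.prems by auto
    from ex_max_deg[OF less.prems(1) this less.prems(2)]
    obtain v where v: "v \<in> V" "2 * card M \<le> card V * deg M v" by blast
    have cV: "card (V - {v}) = 6" using v(1) True less.prems by simp
    have "card {e \<in> M. v \<notin> e} \<le> 3"
      using missing_bound_7[of "card M" "deg M v"] card_remove_vertex[OF finM, of v] v(2) True less.prems by simp
    then have "two_trees (V - {v}) (V - {v}) {e \<in> M. v \<notin> e}"
      using less.prems(1) pairs_remove[OF less.prems(2)] cV by (intro two_spanning_trees) auto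
    then have "two_trees (V - {v}) (V - {v}) M" by (rule two_trees_avoid) auto
    then show ?thesis using v(1) by blast
  next
    case False
    define n where "n = card V - 1"
    have n: "card V = Suc n" and n7: "7 \<le> n" using less.prems(3) False by (auto simp: n_def)
    have finM: "finite M" using less.prems finite_pairs finite_subset by blast
    have "V \<noteq> {}" using n by auto
    from ex_max_deg[OF less.prems(1) this less.prems(2)]
    obtain v where v: "v \<in> V" "\<And>u. u \<in> V \<Longrightarrow> deg M u \<le> deg M v" "2 * card M \<le> card V * deg M v" by blast
    let ?V = "V - {v}" and ?M = "{e \<in> M. v \<notin> e}"
    have cV: "n = card ?V" using v n less.prems(1) by simp
    show ?thesis
    proof (cases "deg M v + 3 \<le> card V")
      case False
      \<comment> \<open>Every range of \<open>missing_bound\<close> stays below this value, since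
        \<open>3 * n - 18 \<le> 2 * n - 6\<close> up to \<open>n = 12\<close>. Removing at least
        \<open>card V - 2\<close> missing edges at \<open>v\<close> then leaves at most
        \<open>card ?V - 3\<close>.\<close>
      have "card M \<le> 2 * card V - 6"
        using less.prems(4) n n7 by (auto simp: missing_bound_def split: if_splits)
      then have "card ?M \<le> card ?V - 3"
        using card_remove_vertex[OF finM, of v] False n cV n7 by simp
      then have "two_trees ?V ?V ?M"
        using less.prems(1) pairs_remove[OF less.prems(2)] cV n7
        by (intro two_spanning_trees) auto
      then have "two_trees ?V ?V M" by (rule two_trees_avoid) auto
      then show ?thesis using v(1) by blast
    next
      case True
      \<comment> \<open>As \<open>v\<close> has the most missing edges, every vertex has two
        neighbours; this is needed below for \<open>w\<close>.\<close>
      then have du: "deg M u + 3 \<le> card V" if "u \<in> V" for u using v(2)[OF that] by linarith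
      have "card ?M \<le> missing_bound (card ?V)"
        using missing_bound_Suc[OF n7] less.prems(4) v(3) n cV card_remove_vertex[OF finM, of v]
        by simp
      moreover have "?M \<subseteq> pairs ?V" by (rule pairs_remove[OF less.prems(2)])
      ultimately have "\<exists>w\<in>?V. \<exists>U. (U = ?V \<or> U = ?V - {w}) \<and> two_trees (?V - {w}) U ?M"
        using less.hyps[of ?V ?M] less.prems(1) n n7 cV by simp
      then obtain w U where w: "w \<in> ?V" "U = ?V \<or> U = ?V - {w}" "two_trees (?V - {w}) U ?M"
        by blast
      have ins: "insert v (?V - {w}) = V - {w}" "insert v ?V = V" using v(1) w(1) by auto
      obtain p q where pq: "p \<in> ?V" "q \<in> ?V" "p \<noteq> q" "{p, v} \<notin> M" "{q, v} \<notin> M"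
        using two_neighbours[OF less.prems(1) finM v(1) True] .
      have nbr: "\<exists>x. x \<in> ?V \<and> x \<noteq> w \<and> {x, v} \<notin> M"
        using pq by (cases "p = w") blast+
      show ?thesis
      proof (cases "U = ?V")
        case True
        \<comment> \<open>Only the first tree misses \<open>w\<close>, so of the two neighbours of
          \<open>v\<close> one different from \<open>w\<close> goes to the first tree.\<close>
        obtain x y where "x \<in> ?V - {w}" "y \<in> ?V" "x \<noteq> y" "{x, v} \<notin> M" "{y, v} \<notin> M"
          using pq by (cases "p = w") blast+
        then have "two_trees (insert v (?V - {w})) (insert v ?V) M"
          using w(3) True by (intro two_trees_leaves[of _ _ _ _ x y]) auto
        then show ?thesis using ins w(1) by auto
      next
        case False
        then have U: "U = ?V - {w}" using w(2) by blast
        show ?thesis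
        proof (cases "{w, v} \<in> M")
          case True
          \<comment> \<open>Here neither \<open>p\<close> nor \<open>q\<close> is \<open>w\<close>,
            so both lie in the two trees.\<close>
          then have "two_trees (insert v (?V - {w})) (insert v (?V - {w})) M"
            using w(3) U pq by (intro two_trees_leaves[of _ _ _ _ p q]) auto
          then show ?thesis using ins w(1) by auto
        next
          case False
          text \<open>If \<open>w\<close> is one of only two neighbours of \<open>v\<close>, then the second tree reaches \<open>v\<close> through \<open>w\<close>.\<close>
          obtain x where x: "x \<in> ?V" "x \<noteq> w" "{x, v} \<notin> M" using nbr by blast
          have "w \<in> V" using w(1) by simp
          obtain r s where "r \<in> V - {w}" "s \<in> V - {w}" "r \<noteq> s" "{r, w} \<notin> M" "{s, w} \<notin> M"
            using two_neighbours[OF less.prems(1) finM \<open>w \<in> V\<close> du[OF \<open>w \<in> V\<close>]] .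
          \<comment> \<open>The second tree must take in \<open>w\<close> before \<open>v\<close>
            returns, hence through a neighbour of \<open>w\<close> other than
            \<open>v\<close>.\<close>
          then obtain y where y: "y \<in> V - {w}" "y \<noteq> v" "{y, w} \<notin> M" by (cases "r = v") blast+
          have "two_trees (?V - {w}) (insert w (?V - {w})) ?M"
            using w(3) U y by (intro two_trees_leaf) auto
          moreover have "insert w (?V - {w}) = ?V" using w(1) by auto
          ultimately have "two_trees (?V - {w}) ?V ?M" by simp
          then have "two_trees (insert v (?V - {w})) (insert v ?V) M"
            using x False w(1) by (intro two_trees_leaves[of _ _ _ _ x w]) auto
          then show ?thesis using ins w(1) by auto
        qed
      qed
    qed
  qed
qed

section \<open>The parameters and their extremal functions\<close>

lemma simple_graph_edges: "simple_graph G \<Longrightarrow> edges G \<subseteq> pairs (vertices G)"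
  by (auto simp: simple_graph_def pairs_def)

text \<open>A connecting tree is a pair of a vertex subset and an edge subset, so there are finitely
  many. The free predicate \<open>P\<close> serves both kinds of disjointness.\<close>

lemma finite_tree_families:
  assumes "simple_graph G"
  shows "finite {card F | F. (\<forall>T\<in>F. tree_connecting G S T) \<and> P F}"
proof -
  have "finite (edges G)"
    using assms finite_subset[OF simple_graph_edges[OF assms] finite_pairs] by (simp add: simple_graph_def)
  then have "finite (Pow (vertices G) \<times> Pow (edges G))" using assms by (simp add: simple_graph_def)
  moreover have "{T. tree_connecting G S T} \<subseteq> Pow (vertices G) \<times> Pow (edges G)"
    by (auto simp: tree_connecting_def is_subgraph_def)
  ultimately have "finite {T. tree_connecting G S T}" by (rule rev_finite_subset)
  then have "finite (card ` Pow {T. tree_connecting G S T})" by simp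
  then show ?thesis by (rule rev_finite_subset) auto
qed

lemma card_le_kappa:
  assumes "simple_graph G" "\<forall>T\<in>F. tree_connecting G S T" "pairwise (internally_disjoint S) F"
  shows "card F \<le> kappa G S"
  unfolding kappa_def by (rule Max_ge[OF finite_tree_families[OF assms(1)]]) (use assms in blast)

lemma lambda_le:
  assumes "simple_graph G"
    and "\<And>F. \<forall>T\<in>F. tree_connecting G S T \<Longrightarrow> pairwise edge_disjoint F \<Longrightarrow> card F \<le> m"
  shows "lambda G S \<le> m"
  unfolding lambda_def
proof (rule Max.boundedI[OF finite_tree_families[OF assms(1)]])
  show "{card F | F. (\<forall>T\<in>F. tree_connecting G S T) \<and> pairwise edge_disjoint F} \<noteq> {}"
    by (auto intro!: exI[of _ "{}"])
qed (use assms(2) in auto)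

lemma kappa_le_lambda:
  assumes "simple_graph G"
  shows "kappa G S \<le> lambda G S"
  unfolding kappa_def lambda_def
proof (rule Max_mono[OF _ _ finite_tree_families[OF assms]])
  have "pairwise edge_disjoint F" if "pairwise (internally_disjoint S) F" for F
    using that by (auto simp: pairwise_def internally_disjoint_def edge_disjoint_def)
  then show "{card F | F. (\<forall>T\<in>F. tree_connecting G S T) \<and> pairwise (internally_disjoint S) F}
      \<subseteq> {card F | F. (\<forall>T\<in>F. tree_connecting G S T) \<and> pairwise edge_disjoint F}"
    by blast
  show "{card F | F. (\<forall>T\<in>F. tree_connecting G S T) \<and> pairwise (internally_disjoint S) F} \<noteq> {}"
    by (auto intro!: exI[of _ "{}"])
qed

lemma finite_k_subsets: "simple_graph G \<Longrightarrow> finite {h S | S. S \<subseteq> vertices G \<and> card S = k}"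
  by (rule finite_subset[of _ "h ` Pow (vertices G)"]) (auto simp: simple_graph_def)

lemma ex_k_subset: "k \<le> card V \<Longrightarrow> \<exists>S. S \<subseteq> V \<and> card S = k"
  by (meson obtain_subset_with_card_n)

lemma kappa_le_kappa_bar:
  "simple_graph G \<Longrightarrow> S \<subseteq> vertices G \<Longrightarrow> kappa G S \<le> kappa_bar (card S) G"
  unfolding kappa_bar_def by (rule Max_ge[OF finite_k_subsets]) auto

lemma lambda_bar_le:
  assumes "simple_graph G" "k \<le> card (vertices G)"
    and "\<And>S. S \<subseteq> vertices G \<Longrightarrow> card S = k \<Longrightarrow> lambda G S \<le> m"
  shows "lambda_bar k G \<le> m"
  unfolding lambda_bar_def
proof (rule Max.boundedI[OF finite_k_subsets[OF assms(1)]])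
  show "{lambda G S | S. S \<subseteq> vertices G \<and> card S = k} \<noteq> {}" using ex_k_subset[OF assms(2)] by blast
qed (use assms(3) in auto)

lemma kappa_bar_le_lambda_bar:
  assumes "simple_graph G" "k \<le> card (vertices G)"
  shows "kappa_bar k G \<le> lambda_bar k G"
  unfolding kappa_bar_def
proof (rule Max.boundedI[OF finite_k_subsets[OF assms(1)]])
  show "{kappa G S | S. S \<subseteq> vertices G \<and> card S = k} \<noteq> {}" using ex_k_subset[OF assms(2)] by blast
next
  fix a assume "a \<in> {kappa G S | S. S \<subseteq> vertices G \<and> card S = k}"
  then obtain S where S: "a = kappa G S" "S \<subseteq> vertices G" "card S = k" by blast
  have "lambda G S \<le> lambda_bar k G"
    unfolding lambda_bar_def by (rule Max_ge[OF finite_k_subsets[OF assms(1)]]) (use S in blast)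
  then show "a \<le> lambda_bar k G" using kappa_le_lambda[OF assms(1), of S] S(1) by simp
qed

text \<open>Infinitely many graphs on naturals have order \<open>n\<close>, but their edge counts
  are bounded by \<open>n choose 2\<close>.\<close>

lemma finite_edge_counts:
  "finite {card (edges G) | G :: nat ugraph. simple_graph G \<and> card (vertices G) = n \<and> P G}"
proof (rule finite_subset)
  have "card (edges G) \<le> n choose 2" if "simple_graph G" "card (vertices G) = n" for G :: "nat ugraph"
    using card_mono[OF finite_pairs simple_graph_edges[OF that(1)]] card_pairs[of "vertices G"] that
    by (simp add: simple_graph_def)
  then show "{card (edges G) | G :: nat ugraph. simple_graph G \<and> card (vertices G) = n \<and> P G}
      \<subseteq> {..n choose 2}" by auto
qed simp

lemma card_edges_le_g_max:
  fixes G :: "nat ugraph"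
  assumes "simple_graph G" "card (vertices G) = n" "lambda_bar k G \<le> l"
  shows "card (edges G) \<le> g_max n k l"
  unfolding g_max_def by (rule Max_ge[OF finite_edge_counts]) (use assms in blast)

lemma g_max_le_f_max:
  fixes G :: "nat ugraph"
  assumes "simple_graph G" "card (vertices G) = n" "lambda_bar k G \<le> l" "k \<le> n"
  shows "g_max n k l \<le> f_max n k l"
  unfolding g_max_def f_max_def
proof (rule Max_mono[OF _ _ finite_edge_counts])
  have "kappa_bar k H \<le> l" if "simple_graph H" "card (vertices H) = n" "lambda_bar k H \<le> l"
    for H :: "nat ugraph"
    using kappa_bar_le_lambda_bar[of H k] that assms(4) by simp
  then show "{card (edges G) | G :: nat ugraph. simple_graph G \<and> card (vertices G) = n \<and> lambda_bar k G \<le> l}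
      \<subseteq> {card (edges G) | G :: nat ugraph. simple_graph G \<and> card (vertices G) = n \<and> kappa_bar k G \<le> l}"
    by blast
qed (use assms in blast)

lemma f_max_le:
  fixes G :: "nat ugraph"
  assumes "simple_graph G" "card (vertices G) = n" "lambda_bar k G \<le> l" "k \<le> n"
    and "\<And>H :: nat ugraph. simple_graph H \<Longrightarrow> card (vertices H) = n \<Longrightarrow> kappa_bar k H \<le> l \<Longrightarrow> card (edges H) \<le> m"
  shows "f_max n k l \<le> m"
  unfolding f_max_def
proof (rule Max.boundedI[OF finite_edge_counts])
  have "kappa_bar k G \<le> l" using kappa_bar_le_lambda_bar[of G k] assms by simp
  then show "{card (edges G) | G :: nat ugraph. simple_graph G \<and> card (vertices G) = n \<and> kappa_bar k G \<le> l} \<noteq> {}"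
    using assms(1,2) by blast
qed (use assms(5) in blast)

section \<open>The lower bound\<close>

lemma connected_graph_edge_at:
  assumes "connected_graph T" "u \<in> vertices T" "v \<in> vertices T" "u \<noteq> v"
  shows "\<exists>e\<in>edges T. u \<in> e"
proof -
  have "(u, v) \<in> {(x, y). {x, y} \<in> edges T}\<^sup>*" using assms by (auto simp: connected_graph_def)
  then obtain w where "{u, w} \<in> edges T" using assms(4) by (auto elim: converse_rtranclE)
  then show ?thesis by auto
qed

text \<open>Each tree needs an edge at \<open>v\<close> to reach another vertex of \<open>S\<close>,
  and edge-disjoint trees need different ones.\<close>

lemma lambda_le_degree:
  assumes "simple_graph G" "v \<in> S" "2 \<le> card S"
  shows "lambda G S \<le> deg (edges G) v"
proof (rule lambda_le[OF assms(1)])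
  fix F assume F: "\<forall>T\<in>F. tree_connecting G S T" "pairwise edge_disjoint F"
  have "S \<noteq> {v}" using assms(3) by auto
  then obtain u where u: "u \<in> S" "v \<noteq> u" using assms(2) by blast
  have "\<exists>e\<in>edges T. v \<in> e" if "T \<in> F" for T
  proof (rule connected_graph_edge_at[of T v u])
    show "connected_graph T" using F(1) that by (auto simp: tree_connecting_def is_tree_def)
  qed (use F(1) that u assms(2) in \<open>auto simp: tree_connecting_def\<close>)
  then obtain h where h: "\<And>T. T \<in> F \<Longrightarrow> h T \<in> edges T \<and> v \<in> h T" by metis
  show "card F \<le> deg (edges G) v"
  proof (rule card_inj_on_le)
    show "inj_on h F"
    proof (rule inj_onI, rule ccontr)
      fix T T' assume T: "T \<in> F" "T' \<in> F" "h T = h T'" "T \<noteq> T'"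
      then have "edges T \<inter> edges T' = {}" using F(2) by (simp add: pairwise_def edge_disjoint_def)
      then show False using h[OF T(1)] h[OF T(2)] T(3) by auto
    qed
    have "edges T \<subseteq> edges G" if "T \<in> F" for T
      using F(1) that by (auto simp: tree_connecting_def is_subgraph_def)
    then show "h ` F \<subseteq> {e \<in> edges G. v \<in> e}"
      using h by blast
    show "finite {e \<in> edges G. v \<in> e}"
      using finite_subset[OF simple_graph_edges[OF assms(1)] finite_pairs] assms(1)
      by (simp add: simple_graph_def)
  qed
qed

definition extremal_graph :: "nat \<Rightarrow> nat \<Rightarrow> nat \<Rightarrow> nat ugraph" where
  "extremal_graph n k l = ({..<n}, pairs {..<k - 1} \<union> (\<lambda>(i, j). {i, j}) ` ({..<l} \<times> {k - 1..<n}))"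

lemma extremal_graph:
  assumes "3 \<le> k" "k \<le> n" "l \<le> k - 1"
  shows "simple_graph (extremal_graph n k l)" "card (vertices (extremal_graph n k l)) = n"
    "card (edges (extremal_graph n k l)) = ((k - 1) choose 2) + (n - k + 1) * l"
    "lambda_bar k (extremal_graph n k l) \<le> l"
proof -
  let ?G = "extremal_graph n k l"
  let ?J = "(\<lambda>(i, j). {i, j}) ` ({..<l} \<times> {k - 1..<n})"
  show simple: "simple_graph ?G"
    using assms by (auto simp: extremal_graph_def simple_graph_def pairs_def card_insert_if)
  show n: "card (vertices ?G) = n" by (simp add: extremal_graph_def)
  \<comment> \<open>Since \<open>i < l \<le> k - 1 \<le> j\<close>, the smaller endpoint determines
    which component it is.\<close>
  have "inj_on (\<lambda>(i, j). {i, j}) ({..<l} \<times> {k - 1..<n})"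
    using assms(3) by (auto simp: inj_on_def doubleton_eq_iff)
  then have "card ?J = card ({..<l} \<times> {k - 1..<n})" by (rule card_image)
  also have "\<dots> = (n - (k - 1)) * l" by simp
  also have "n - (k - 1) = n - k + 1" using assms by simp
  finally have "card ?J = (n - k + 1) * l" .
  moreover have "pairs {..<k - 1} \<inter> ?J = {}" by (auto simp: pairs_def)
  moreover have "finite ?J" by simp
  ultimately show "card (edges ?G) = ((k - 1) choose 2) + (n - k + 1) * l"
    by (simp add: extremal_graph_def card_Un_disjoint finite_pairs card_pairs)
  show "lambda_bar k ?G \<le> l"
  proof (rule lambda_bar_le[OF simple])
    show "k \<le> card (vertices ?G)" using n assms by simp
    fix S assume S: "S \<subseteq> vertices ?G" "card S = k"
    have "\<not> S \<subseteq> {..<k - 1}"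
      using card_mono[of "{..<k - 1}" S] S(2) assms by auto
    then obtain v where "v \<in> S" "v \<notin> {..<k - 1}" by blast
    then have v: "v \<in> S" "k - 1 \<le> v" by auto
    have "{e \<in> edges ?G. v \<in> e} \<subseteq> (\<lambda>i. {i, v}) ` {..<l}"
      using v(2) assms(3) by (auto simp: extremal_graph_def pairs_def)
    then have "deg (edges ?G) v \<le> card {..<l}" by (rule surj_card_le[rotated]) simp
    then show "lambda ?G S \<le> l"
      using lambda_le_degree[OF simple v(1)] S(2) assms by simp
  qed
qed

section \<open>The upper bounds\<close>

text \<open>Because the first tree has vertex set exactly \<open>S\<close> and
  \<open>S \<subseteq> V\<close>, the trees meet in \<open>S\<close> alone and edge-disjointness
  becomes internal disjointness.\<close>

lemma two_le_kappa_bar: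
  assumes "simple_graph G" "S \<subseteq> V" "V \<subseteq> vertices G" "2 \<le> card S"
    and "two_trees S V (pairs (vertices G) - edges G)"
  shows "2 \<le> kappa_bar (card S) G"
proof -
  obtain E1 E2 where E: "leaf_tree S E1" "leaf_tree V E2" "E1 \<inter> E2 = {}"
    "(E1 \<union> E2) \<inter> (pairs (vertices G) - edges G) = {}"
    using assms(5) by (auto simp: two_trees_def)
  have "E1 \<union> E2 \<subseteq> pairs (vertices G)"
    using leaf_tree_edge[OF E(1)] leaf_tree_edge[OF E(2)] assms(2,3) unfolding pairs_def by blast
  then have "E1 \<subseteq> edges G" "E2 \<subseteq> edges G" using E(4) by blast+
  then have conn: "tree_connecting G S (S, E1)" "tree_connecting G S (V, E2)"
    using assms E(1,2)
    by (auto simp: tree_connecting_def is_subgraph_def leaf_tree_is_tree leaf_tree_simple)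
  \<comment> \<open>\<open>S\<close> and \<open>V\<close> may coincide, so the edge sets must tell
    the two trees apart.\<close>
  have "E1 \<noteq> {}" using leaf_tree_no_edges[of S] E(1) assms(4) by auto
  then have "E1 \<noteq> E2" using E(3) by auto
  then have "card {(S, E1), (V, E2)} = 2" by simp
  moreover have "pairwise (internally_disjoint S) {(S, E1), (V, E2)}"
    using E(3) assms(2) by (auto simp: pairwise_def internally_disjoint_def)
  ultimately have "2 \<le> kappa G S"
    using card_le_kappa[OF assms(1), of "{(S, E1), (V, E2)}" S] conn by simp
  also have "\<dots> \<le> kappa_bar (card S) G"
    using assms(2,3) by (intro kappa_le_kappa_bar[OF assms(1)]) simp
  finally show ?thesis .
qed

lemma card_missing_edges:
  assumes "simple_graph G"
  shows "card (pairs (vertices G) - edges G) = (card (vertices G) choose 2) - card (edges G)"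
proof -
  have "finite (vertices G)" using assms by (simp add: simple_graph_def)
  then show ?thesis
    using simple_graph_edges[OF assms] finite_pairs[of "vertices G"] card_pairs[of "vertices G"]
    by (metis card_Diff_subset finite_subset)
qed

lemma choose_2_Suc: "Suc n choose 2 = n + (n choose 2)"
  by (simp add: numeral_2_eq_2)

text \<open>One edge beyond the bound leaves at most \<open>(n - 1) - 2 = n - 3\<close> missing
  edges, the threshold of \<open>two_spanning_trees\<close>.\<close>

lemma card_edges_le_spanning:
  assumes "simple_graph G" "card (vertices G) = n" "5 \<le> n" "kappa_bar n G \<le> 1"
  shows "card (edges G) \<le> ((n - 1) choose 2) + 1"
proof (rule ccontr)
  let ?M = "pairs (vertices G) - edges G"
  assume "\<not> card (edges G) \<le> ((n - 1) choose 2) + 1"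
  moreover have "n choose 2 = n - 1 + ((n - 1) choose 2)" using choose_2_Suc[of "n - 1"] assms(3) by simp
  ultimately have "card ?M \<le> n - 3" using card_missing_edges[OF assms(1), unfolded assms(2)] assms(3) by linarith
  then have "two_trees (vertices G) (vertices G) ?M"
    using assms by (intro two_spanning_trees) (auto simp: simple_graph_def)
  then have "2 \<le> kappa_bar n G"
    using two_le_kappa_bar[OF assms(1), of "vertices G" "vertices G"] assms by simp
  then show False using assms(4) by simp
qed

lemma card_edges_le_almost_spanning:
  assumes "simple_graph G" "card (vertices G) = n" "12 \<le> n" "kappa_bar (n - 1) G \<le> 1"
  shows "card (edges G) \<le> ((n - 2) choose 2) + 2"
proof (rule ccontr)
  let ?V = "vertices G" and ?M = "pairs (vertices G) - edges G"
  have fin: "finite ?V" using assms(1) by (simp add: simple_graph_def)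
  assume "\<not> card (edges G) \<le> ((n - 2) choose 2) + 2"
  moreover have "n choose 2 = n - 1 + (n - 2 + ((n - 2) choose 2))"
    using choose_2_Suc[of "n - 1"] choose_2_Suc[of "n - 2"] assms(3) by (simp add: Suc_diff_Suc numeral_2_eq_2)
  ultimately have "card ?M \<le> 2 * n - 6" using card_missing_edges[OF assms(1), unfolded assms(2)] assms(3) by linarith
  \<comment> \<open>At \<open>n = 12\<close> the middle and last branches agree,
    \<open>3 * n - 18 = 2 * n - 6\<close>; this is where \<open>12 \<le> n\<close> enters.\<close>
  then have "card ?M \<le> missing_bound (card ?V)" using assms(2,3) by (auto simp: missing_bound_def)
  then obtain w U where w: "w \<in> ?V" "U = ?V \<or> U = ?V - {w}" "two_trees (?V - {w}) U ?M"
    using two_trees_one_avoiding_vertex[OF fin, of ?M] assms(2,3) by auto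
  have "card (?V - {w}) = n - 1" using w(1) fin assms(2) by simp
  moreover have "?V - {w} \<subseteq> U" "U \<subseteq> ?V" using w(2) by auto
  ultimately have "2 \<le> kappa_bar (n - 1) G"
    using two_le_kappa_bar[OF assms(1) _ _ _ w(3)] assms(3) by simp
  then show False using assms(4) by simp
qed

theorem mainTheorem7:
  shows "(\<forall>n k l :: nat. 3 \<le> k \<and> k \<le> n \<and> 1 \<le> l \<and> l \<le> (k - 1) div 2 \<longrightarrow>
            f_max n k l \<ge> ((k - 1) choose 2) + (n - k + 1) * l \<and>
            g_max n k l \<ge> ((k - 1) choose 2) + (n - k + 1) * l) \<and>
         (\<forall>n k :: nat. (k = n \<and> 6 \<le> n) \<or> (k = n - 1 \<and> 12 \<le> n) \<longrightarrow>
            (\<exists>l. 1 \<le> l \<and> l \<le> (k - 1) div 2 \<and>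
               f_max n k l = ((k - 1) choose 2) + (n - k + 1) * l \<and>
               g_max n k l = ((k - 1) choose 2) + (n - k + 1) * l))"
proof -
  have lower: "((k - 1) choose 2) + (n - k + 1) * l \<le> g_max n k l" "g_max n k l \<le> f_max n k l"
    if "3 \<le> k" "k \<le> n" "l \<le> (k - 1) div 2" for n k l
  proof -
    have "l \<le> k - 1" using that by linarith
    note G = extremal_graph[OF that(1,2) this]
    show "((k - 1) choose 2) + (n - k + 1) * l \<le> g_max n k l"
      using card_edges_le_g_max[OF G(1,2,4)] G(3) by simp
    show "g_max n k l \<le> f_max n k l" by (rule g_max_le_f_max[OF G(1,2,4) that(2)])
  qed
  \<comment> \<open>Bounding \<open>f_max\<close> from above suffices: \<open>g_max\<close> is
    squeezed between the lower bound and \<open>f_max\<close>, so both equalities follow for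
    \<open>l = 1\<close>.\<close>
  have upper: "f_max n k 1 \<le> ((k - 1) choose 2) + (n - k + 1) * 1"
    if nk: "(k = n \<and> 6 \<le> n) \<or> (k = n - 1 \<and> 12 \<le> n)" for n k
  proof -
    have k: "3 \<le> k" "k \<le> n" "1 \<le> k - 1" using nk by auto
    note G = extremal_graph[OF k]
    show ?thesis
    proof (rule f_max_le[OF G(1,2,4) k(2)])
      fix H :: "nat ugraph"
      assume H: "simple_graph H" "card (vertices H) = n" "kappa_bar k H \<le> 1"
      show "card (edges H) \<le> ((k - 1) choose 2) + (n - k + 1) * 1"
      proof (cases "k = n")
        case True
        then show ?thesis using card_edges_le_spanning[OF H(1,2)] H(3) nk by auto
      next
        case False
        then have "k = n - 1" "12 \<le> n" using nk by auto
        moreover from this have "k - 1 = n - 2" "n - k + 1 = 2" by auto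
        ultimately show ?thesis using card_edges_le_almost_spanning[OF H(1,2)] H(3) by simp
      qed
    qed
  qed
  have "1 \<le> (k - 1) div 2 \<and> f_max n k 1 = ((k - 1) choose 2) + (n - k + 1) * 1 \<and>
      g_max n k 1 = ((k - 1) choose 2) + (n - k + 1) * 1"
    if nk: "(k = n \<and> 6 \<le> n) \<or> (k = n - 1 \<and> 12 \<le> n)" for n k
  proof -
    have "3 \<le> k" "k \<le> n" "1 \<le> (k - 1) div 2" using nk by auto
    then show ?thesis using lower[of k n 1] upper[OF nk] by linarith
  qed
  then have sharp: "\<exists>l. 1 \<le> l \<and> l \<le> (k - 1) div 2 \<and>
      f_max n k l = ((k - 1) choose 2) + (n - k + 1) * l \<and>
      g_max n k l = ((k - 1) choose 2) + (n - k + 1) * l"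
    if "(k = n \<and> 6 \<le> n) \<or> (k = n - 1 \<and> 12 \<le> n)" for n k
    using that by (intro exI[of _ 1]) simp
  have "((k - 1) choose 2) + (n - k + 1) * l \<le> f_max n k l"
    if "3 \<le> k" "k \<le> n" "l \<le> (k - 1) div 2" for n k l
    using lower[OF that] by (rule order_trans)
  then show ?thesis using lower(1) sharp by blast
qed

end
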